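(* Let $G=(V,E)$ be a connected, undirected simple graph and let $S\subsetneq V$, $S\neq\emptyset$. Then the cut-set constraint $$\sum_{e\in\delta(S)}x_e\geq 1$$ is a Chv\'atal-Gomory cut with respect to the mixed-integer semidefinite program (MISDP) for the quadratic minimum spanning tree problem on $G$ given in the context.
   Context: Let $n=|V|$, $m=|E|$, with a fixed ordering of $E$, and put $\beta=2(1-\cos(\pi/n))$, $\alpha=\beta/n$. $\mathcal{S}^k$ denotes the real symmetric $k\times k$ matrices, $\mathbf{1}$ the all-ones vector, $\mathbf{J}_n$ the all-ones matrix, $\mathbf{I}_n$ the identity matrix; $\succeq\mathbf{0}$ means positive semidefinite; $\langle X,Y\rangle=\mathrm{tr}(XY)$; $\mathrm{diag}(Y)$ is the vector of diagonal entries and $\mathrm{Diag}(v)$ the diagonal matrix with diagonal $v$. $\delta(S)$ is the set of edges with exactly one endpoint in $S$. For $X=(x_{ij})\in\mathcal{S}^n$ supported on $E$, $\mathcal{B}(X)\in\mathbb{R}^m$ is the vector of entries $x_e:=x_{ij}$, $e=\{i,j\}\in E$. The MISDP for the quadratic minimum spanning tree problem with cost matrix $Q\in\mathcal{S}^m$ is: minimize $\langle Q,Y\rangle$ over $Y=(y_{ef})\in\mathcal{S}^m$ and $X\in\{0,1\}^{n\times n}\cap\mathcal{S}^n$ with $\langle X,\mathbf{J}_n\rangle=2(n-1)$ and $x_{ij}=0$ if $\{i,j\}\notin E$, subject to $$\mathrm{diag}(Y)=\mathcal{B}(X),\qquad \begin{pmatrix} Y & \mathcal{B}(X)\\ \mathcal{B}(X)^\top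 & 1\end{pmatrix}\succeq\mathbf{0},\qquad \mathrm{Diag}(X\mathbf{1})-X+\alpha\mathbf{J}_n-\beta\mathbf{I}_n\succeq\mathbf{0}.$$ At feasible points all entries of $Y$ are in $\{0,1\}$. Its continuous (doubly nonnegative) relaxation is obtained by replacing $X\in\{0,1\}^{n\times n}$ by $X\in[0,1]^{n\times n}$ and requiring all entries of $Y$ to be nonnegative. Chv\'atal-Gomory cut: if an inequality $\sum_{e\in E}c_e x_e+\sum_{\{e,f\}\subseteq E,\,e\neq f}c_{ef}\,y_{ef}\geq d$ with integer coefficients $c_e,c_{ef}$ and $d\in\mathbb{R}$ is valid for all points of the continuous relaxation (for example, because it arises by taking the trace inner product of a linear matrix inequality of the program with a positive semidefinite matrix), then the inequality with the same left-hand side and right-hand side $\lceil d\rceil$ is a Chv\'atal-Gomory cut with respect to the MISDP. (Equivalently, for inequalities written with $\leq$, the right-hand side is rounded down.) *)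

theory Defs
  imports Complex_Main "Jordan_Normal_Form.Matrix"
begin

section \<open>Real symmetric matrices\<close>

definition sym_mats :: "nat \<Rightarrow> real mat set" where
  "sym_mats k = {A \<in> carrier_mat k k. transpose_mat A = A}"

definition mat_inner :: "real mat \<Rightarrow> real mat \<Rightarrow> real" where
  "mat_inner X Y = sum_list (diag_mat (X * Y))"

definition psd :: "real mat \<Rightarrow> bool" where
  "psd A \<longleftrightarrow> A \<in> sym_mats (dim_row A) \<and>
     (\<forall>v \<in> carrier_vec (dim_row A). 0 \<le> v \<bullet> (A *\<^sub>v v))"

definition ones_vec :: "nat \<Rightarrow> real vec" where
  "ones_vec n = vec n (\<lambda>_. 1)"

definition ones_mat :: "nat \<Rightarrow> real mat" where
  "ones_mat n = mat n n (\<lambda>_. 1)"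

section \<open>Instances of the quadratic minimum spanning tree problem\<close>

text \<open>
  An instance is a graph with a cost matrix. The lists enumerate the vertices and the edges
  (two-element vertex sets); they fix the indexing of the rows and columns of the matrices
  below.
\<close>

record 'a qmstp =
  verts :: "'a list"
  edges :: "'a set list"
  cost :: "real mat"

definition num_verts :: "('a, 'b) qmstp_scheme \<Rightarrow> nat" where
  "num_verts G = length (verts G)"

definition num_edges :: "('a, 'b) qmstp_scheme \<Rightarrow> nat" where
  "num_edges G = length (edges G)"

definition qmstp_instance :: "('a, 'b) qmstp_scheme \<Rightarrow> bool" where
  "qmstp_instance G \<longleftrightarrow>
     distinct (verts G) \<and> distinct (edges G) \<and>
     (\<forall>e \<in> set (edges G). e \<subseteq> set (verts G) \<and> card e = 2) \<and>
     cost G \<in> sym_mats (num_edges G)"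

definition connected_graph :: "('a, 'b) qmstp_scheme \<Rightarrow> bool" where
  "connected_graph G \<longleftrightarrow> set (verts G) \<noteq> {} \<and>
     (\<forall>u \<in> set (verts G). \<forall>v \<in> set (verts G).
        (u, v) \<in> {(a, b). {a, b} \<in> set (edges G)}\<^sup>*)"

definition cut_edges :: "('a, 'b) qmstp_scheme \<Rightarrow> 'a set \<Rightarrow> 'a set set" where
  "cut_edges G S = {e \<in> set (edges G). card (e \<inter> S) = 1}"

section \<open>The mixed-integer semidefinite program and its relaxation\<close>

definition beta :: "('a, 'b) qmstp_scheme \<Rightarrow> real" where
  "beta G = 2 * (1 - cos (pi / real (num_verts G)))"

definition alpha :: "('a, 'b) qmstp_scheme \<Rightarrow> real" where
  "alpha G = beta G / real (num_verts G)"

text \<open>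
  The entry of a symmetric \<open>X\<close> belonging to an edge, read off above the diagonal so that the
  position is unique.
\<close>

definition edge_var :: "('a, 'b) qmstp_scheme \<Rightarrow> real mat \<Rightarrow> 'a set \<Rightarrow> real" where
  "edge_var G X e =
     X $$ (THE (i, j). i < j \<and> j < num_verts G \<and> e = {verts G ! i, verts G ! j})"

definition edge_vec :: "('a, 'b) qmstp_scheme \<Rightarrow> real mat \<Rightarrow> real vec" where
  "edge_vec G X = vec (num_edges G) (\<lambda>k. edge_var G X (edges G ! k))"

text \<open>
  The constraints shared by the program and its relaxation, which differ in the set \<open>D\<close> of
  admissible entries of \<open>X\<close> and in the nonnegativity of \<open>Y\<close>.
\<close>

definition sdp_constraints ::
  "real set \<Rightarrow> ('a, 'b) qmstp_scheme \<Rightarrow> real mat \<Rightarrow> real mat \<Rightarrow> bool" where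
  "sdp_constraints D G X Y \<longleftrightarrow>
     (let n = num_verts G; m = num_edges G in
       X \<in> sym_mats n \<and> Y \<in> sym_mats m \<and>
       (\<forall>i < n. \<forall>j < n. X $$ (i, j) \<in> D) \<and>
       mat_inner X (ones_mat n) = 2 * (real n - 1) \<and>
       (\<forall>i < n. \<forall>j < n. {verts G ! i, verts G ! j} \<notin> set (edges G) \<longrightarrow> X $$ (i, j) = 0) \<and>
       vec m (\<lambda>k. Y $$ (k, k)) = edge_vec G X \<and>
       psd (four_block_mat Y (mat_of_cols m [edge_vec G X])
                           (mat_of_rows m [edge_vec G X]) (1\<^sub>m 1)) \<and>
       psd (mat_diag n (\<lambda>i. (X *\<^sub>v ones_vec n) $ i) - X
              + alpha G \<cdot>\<^sub>m ones_mat n - beta G \<cdot>\<^sub>m 1\<^sub>m n))"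

definition misdp_feasible :: "('a, 'b) qmstp_scheme \<Rightarrow> real mat \<Rightarrow> real mat \<Rightarrow> bool" where
  "misdp_feasible G X Y \<longleftrightarrow> sdp_constraints {0, 1} G X Y"

definition misdp_objective :: "('a, 'b) qmstp_scheme \<Rightarrow> real mat \<Rightarrow> real" where
  "misdp_objective G Y = mat_inner (cost G) Y"

definition relaxation_feasible :: "('a, 'b) qmstp_scheme \<Rightarrow> real mat \<Rightarrow> real mat \<Rightarrow> bool" where
  "relaxation_feasible G X Y \<longleftrightarrow> sdp_constraints {0..1} G X Y \<and>
     (\<forall>k < num_edges G. \<forall>l < num_edges G. 0 \<le> Y $$ (k, l))"

section \<open>Chvatal-Gomory cuts\<close>

text \<open>
  Unordered pairs of distinct edges correspond to positions \<open>k < l\<close>; accordingly the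
  coefficient of \<open>y\<close> is indexed by the set \<open>{e, f}\<close>.
\<close>

definition integer_form ::
  "('a, 'b) qmstp_scheme \<Rightarrow> ('a set \<Rightarrow> int) \<Rightarrow> ('a set set \<Rightarrow> int)
     \<Rightarrow> real mat \<Rightarrow> real mat \<Rightarrow> real" where
  "integer_form G c c' X Y =
     (\<Sum>e \<in> set (edges G). of_int (c e) * edge_var G X e) +
     (\<Sum>l < num_edges G. \<Sum>k < l. of_int (c' {edges G ! k, edges G ! l}) * Y $$ (k, l))"

text \<open>
  \<open>cg_cut G lhs r\<close>: the inequality \<open>lhs X Y \<ge> r\<close> is a Chvatal-Gomory cut with respect to the
  mixed-integer semidefinite program for \<open>G\<close>.
\<close>

definition cg_cut :: "('a, 'b) qmstp_scheme \<Rightarrow> (real mat \<Rightarrow> real mat \<Rightarrow> real) \<Rightarrow> int \<Rightarrow> bool" where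
  "cg_cut G lhs r \<longleftrightarrow>
     (\<exists>c c'. \<exists>d :: real.
        (\<forall>X \<in> sym_mats (num_verts G). \<forall>Y \<in> sym_mats (num_edges G).
           lhs X Y = integer_form G c c' X Y) \<and>
        (\<forall>X Y. relaxation_feasible G X Y \<longrightarrow> lhs X Y \<ge> d) \<and>
        r = \<lceil>d\<rceil>)"

end

theory Submission
  imports Defs
begin

text \<open>
  Testing a linear matrix inequality with the rank-one matrix \<open>z z\<^sup>T\<close>, where \<open>z\<close> is the
  indicator vector of \<open>S\<close>, gives a valid linear inequality. For the Laplacian
  \<open>Diag(X 1) - X\<close> of the weighted graph \<open>X\<close>, the form \<open>z\<^sup>T L z\<close> is the total weight of the
  edges leaving \<open>S\<close>: every weight between two vertices of \<open>S\<close> cancels against the degrees.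
  With \<open>s = |S|\<close>, the remaining terms contribute \<open>\<alpha> s\<^sup>2 - \<beta> s\<close>. Hence the last constraint
  of the program implies that the cut weight is at least
  \<open>\<beta> s - \<alpha> s\<^sup>2 = \<beta> s (n - s) / n\<close> (\<open>sdp_cut_bound\<close>).

  It remains to see that this right-hand side rounds up to 1
  (\<open>cut_bound_pos\<close>, \<open>cut_bound_le_1\<close>).
  It is positive because \<open>0 < s < n\<close> and \<open>\<beta> > 0\<close>. By \<open>s (n - s) \<le> n\<^sup>2/4\<close> it is at most
  \<open>n/2 * (1 - cos (\<pi>/n)) = n sin\<^sup>2 (\<pi>/(2n))\<close>, which equals 1 at \<open>n = 2\<close>, is \<open>3/4\<close> at
  \<open>n = 3\<close>, and is at most \<open>\<pi>\<^sup>2/(4n) < 1\<close> for \<open>n \<ge> 4\<close>.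
\<close>

lemma one_minus_cos_pi_div_le:
  assumes "2 \<le> (n::nat)"
  shows "real n * (1 - cos (pi / real n)) \<le> 2"
proof -
  consider "n = 2" | "n = 3" | "4 \<le> n" using assms by linarith
  then show ?thesis
  proof cases
    case 3
    define x where "x = pi / (2 * real n)"
    have x: "0 \<le> x" "pi / real n = 2 * x" unfolding x_def by auto
    have "(sin x)\<^sup>2 \<le> x\<^sup>2"
      using abs_sin_x_le_abs_x[of x] by (simp add: abs_le_square_iff)
    then have "1 - cos (pi / real n) \<le> 2 * x\<^sup>2"
      by (simp add: x(2) cos_double_sin)
    then have "real n * (1 - cos (pi / real n)) \<le> real n * (2 * x\<^sup>2)"
      by (intro mult_left_mono) auto
    also have "\<dots> = pi\<^sup>2 / (2 * real n)"
      using 3 by (simp add: x_def power2_eq_square field_simps)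
    also have "\<dots> \<le> 4\<^sup>2 / (2 * real n)"
      using pi_less_4 pi_gt_zero by (intro divide_right_mono power_mono) auto
    also have "\<dots> \<le> 2" using 3 by (simp add: field_simps)
    finally show ?thesis .
  qed (simp_all add: cos_60)
qed

lemma beta_pos:
  assumes "2 \<le> num_verts G"
  shows "0 < beta G"
proof -
  have "cos (pi / real (num_verts G)) < cos 0"
    using assms by (intro cos_monotone_0_pi) (auto simp: field_simps)
  then show ?thesis by (simp add: beta_def)
qed

lemma cut_bound_eq:
  assumes "0 < num_verts G"
  shows "beta G * s - alpha G * s\<^sup>2 = beta G * (s * (real (num_verts G) - s)) / real (num_verts G)"
  using assms by (simp add: alpha_def field_simps power2_eq_square)

lemma cut_bound_pos:
  assumes "0 < (s::nat)" "s < num_verts G"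
  shows "0 < beta G * real s - alpha G * (real s)\<^sup>2"
  using assms beta_pos[of G] by (subst cut_bound_eq) auto

lemma cut_bound_le_1:
  assumes "2 \<le> num_verts G"
  shows "beta G * s - alpha G * s\<^sup>2 \<le> 1"
proof -
  let ?n = "real (num_verts G)"
  have "0 \<le> (?n - 2 * s)\<^sup>2" by simp
  then have "s * (?n - s) \<le> ?n\<^sup>2 / 4"
    by (simp add: power2_eq_square algebra_simps)
  then have "beta G * (s * (?n - s)) / ?n \<le> beta G * (?n\<^sup>2 / 4) / ?n"
    using beta_pos[OF assms] by (intro divide_right_mono mult_left_mono) auto
  also have "\<dots> = ?n * (1 - cos (pi / ?n)) / 2"
    using assms by (simp add: beta_def power2_eq_square field_simps)
  also have "\<dots> \<le> 1" using one_minus_cos_pi_div_le[OF assms] by simp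
  finally show ?thesis using assms by (subst cut_bound_eq) auto
qed

text \<open>
  Evaluating the form at an indicator vector is how positive semidefiniteness becomes
  a linear inequality in the entries of the matrix.
\<close>

lemma psd_indicator:
  assumes "psd A" "A \<in> carrier_mat n n" "I \<subseteq> {..<n}"
  shows "0 \<le> (\<Sum>i\<in>I. \<Sum>j\<in>I. A $$ (i, j))"
proof -
  define z :: "real vec" where "z = vec n (\<lambda>i. if i \<in> I then 1 else 0)"
  have restrict: "(\<Sum>i = 0..<n. (if i \<in> I then f i else 0)) = sum f I" for f :: "nat \<Rightarrow> real"
    using assms(3) by (intro sum.mono_neutral_cong_right) (auto simp: lessThan_atLeast0)
  have row: "(A *\<^sub>v z) $ i = (\<Sum>j\<in>I. A $$ (i, j))" if "i < n" for i
  proof -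
    have "(A *\<^sub>v z) $ i = (\<Sum>j = 0..<n. (if j \<in> I then A $$ (i, j) else 0))"
      using that assms(2) by (auto simp: z_def scalar_prod_def intro!: sum.cong)
    then show ?thesis by (simp add: restrict)
  qed
  have z: "z $ i = (if i \<in> I then 1 else 0)" if "i < n" for i
    using that by (simp add: z_def)
  have "z \<bullet> (A *\<^sub>v z) = (\<Sum>i = 0..<n. (if i \<in> I then \<Sum>j\<in>I. A $$ (i, j) else 0))"
    using assms(2) unfolding scalar_prod_def
    by (intro sum.cong) (auto simp: row z simp del: index_mult_mat_vec)
  moreover have "0 \<le> z \<bullet> (A *\<^sub>v z)"
    using assms(1,2) by (auto simp: psd_def z_def)
  ultimately show ?thesis by (simp add: restrict)
qed

text \<open>
  The weights inside \<open>I\<close> appear once in the degrees and once with a minus sign, so only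
  the weights between \<open>I\<close> and its complement survive.
\<close>

lemma laplacian_lmi_cut:
  assumes X: "X \<in> carrier_mat n n" and I: "I \<subseteq> {..<n}"
    and psd: "psd (mat_diag n (\<lambda>i. (X *\<^sub>v ones_vec n) $ i) - X + a \<cdot>\<^sub>m ones_mat n - b \<cdot>\<^sub>m 1\<^sub>m n)"
  shows "b * real (card I) - a * (real (card I))\<^sup>2 \<le> (\<Sum>i\<in>I. \<Sum>j\<in>{..<n} - I. X $$ (i, j))"
proof -
  let ?M = "mat_diag n (\<lambda>i. (X *\<^sub>v ones_vec n) $ i) - X + a \<cdot>\<^sub>m ones_mat n - b \<cdot>\<^sub>m 1\<^sub>m n"
  have fin: "finite I" using I finite_subset by blast
  have deg: "(X *\<^sub>v ones_vec n) $ i = (\<Sum>j<n. X $$ (i, j))" if "i < n" for i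
    using that X by (auto simp: ones_vec_def scalar_prod_def lessThan_atLeast0 intro!: sum.cong)
  have M: "?M \<in> carrier_mat n n" using X by (auto simp: ones_mat_def)
  have entry: "?M $$ (i, j) = (if j = i then (\<Sum>k<n. X $$ (i, k)) - b else 0) - X $$ (i, j) + a"
    if "i < n" "j < n" for i j
    using that X deg[OF that(1)]
    by (auto simp: mat_diag_def ones_mat_def simp del: index_mult_mat_vec)
  have "(\<Sum>j\<in>I. ?M $$ (i, j)) = (\<Sum>j\<in>{..<n} - I. X $$ (i, j)) - b + a * real (card I)"
    if i: "i \<in> I" for i
  proof -
    have "(\<Sum>j\<in>I. ?M $$ (i, j))
        = (\<Sum>j\<in>I. (if j = i then (\<Sum>k<n. X $$ (i, k)) - b else 0) - X $$ (i, j) + a)"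
      using i I by (intro sum.cong refl entry) auto
    also have "\<dots> = (\<Sum>k<n. X $$ (i, k)) - b - (\<Sum>j\<in>I. X $$ (i, j)) + a * real (card I)"
      using i fin by (simp add: sum.distrib sum_subtractf)
    also have "(\<Sum>k<n. X $$ (i, k)) = (\<Sum>j\<in>{..<n} - I. X $$ (i, j)) + (\<Sum>j\<in>I. X $$ (i, j))"
      using I by (intro sum.subset_diff) auto
    finally show ?thesis by simp
  qed
  then have "(\<Sum>i\<in>I. \<Sum>j\<in>I. ?M $$ (i, j))
      = (\<Sum>i\<in>I. (\<Sum>j\<in>{..<n} - I. X $$ (i, j)) - b + a * real (card I))"
    by (rule sum.cong[OF refl])
  also have "\<dots> = (\<Sum>i\<in>I. \<Sum>j\<in>{..<n} - I. X $$ (i, j)) - b * real (card I)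
      + a * (real (card I))\<^sup>2"
    by (simp add: sum.distrib sum_subtractf power2_eq_square)
  finally show ?thesis using psd_indicator[OF psd M I] by linarith
qed

lemma edge_var_nth:
  assumes "distinct (verts G)" "X \<in> sym_mats (num_verts G)"
    and "i < num_verts G" "j < num_verts G" "i \<noteq> j"
  shows "edge_var G X {verts G ! i, verts G ! j} = X $$ (i, j)"
proof -
  have sym: "X $$ (j, i) = X $$ (i, j)"
  proof -
    have X: "X \<in> carrier_mat (num_verts G) (num_verts G)" "transpose_mat X = X"
      using assms(2) by (auto simp: sym_mats_def)
    then have "X $$ (j, i) = transpose_mat X $$ (i, j)"
      using assms(3,4) by (intro index_transpose_mat(1)[symmetric]) auto
    then show ?thesis by (simp add: X(2))
  qed
  have "(THE (k, l). k < l \<and> l < num_verts G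
      \<and> {verts G ! i, verts G ! j} = {verts G ! k, verts G ! l}) = (min i j, max i j)"
    using assms
    by (intro the_equality)
      (auto simp: doubleton_eq_iff nth_eq_iff_index_eq num_verts_def min_def max_def)
  then show ?thesis
    unfolding edge_var_def using sym by (auto simp: min_def max_def)
qed

text \<open>
  Each cut edge has exactly one endpoint in \<open>S\<close>, so orienting it away from \<open>S\<close> gives a unique
  matrix position; the positions that no edge uses carry the entry 0.
\<close>

lemma cut_weight_eq_sum_edge_var:
  fixes G :: "('a, 'b) qmstp_scheme" and S :: "'a set"
  assumes inst: "qmstp_instance G" and X: "X \<in> sym_mats (num_verts G)"
    and supp: "\<And>i j. i < num_verts G \<Longrightarrow> j < num_verts G \<Longrightarrow>
      {verts G ! i, verts G ! j} \<notin> set (edges G) \<Longrightarrow> X $$ (i, j) = 0"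
  defines "I \<equiv> {i. i < num_verts G \<and> verts G ! i \<in> S}"
  shows "(\<Sum>i\<in>I. \<Sum>j\<in>{..<num_verts G} - I. X $$ (i, j)) = (\<Sum>e\<in>cut_edges G S. edge_var G X e)"
proof -
  let ?n = "num_verts G" and ?v = "\<lambda>i. verts G ! i"
  define P where "P = {(i, j) \<in> I \<times> ({..<?n} - I). {?v i, ?v j} \<in> set (edges G)}"
  have dist: "distinct (verts G)" using inst by (simp add: qmstp_instance_def)
  have v_eq: "?v i = ?v j \<longleftrightarrow> i = j" if "i < ?n" "j < ?n" for i j
    using that dist by (simp add: nth_eq_iff_index_eq num_verts_def)
  have fin: "finite I" unfolding I_def by simp
  have "(\<Sum>i\<in>I. \<Sum>j\<in>{..<?n} - I. X $$ (i, j)) = (\<Sum>(i, j)\<in>I \<times> ({..<?n} - I). X $$ (i, j))"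
    by (simp add: sum.cartesian_product)
  also have "\<dots> = (\<Sum>(i, j)\<in>P. X $$ (i, j))"
    using fin unfolding P_def
    by (intro sum.mono_neutral_right) (auto simp: I_def intro!: supp)
  also have "\<dots> = (\<Sum>p\<in>P. edge_var G X {?v (fst p), ?v (snd p)})"
    using dist X by (intro sum.cong) (auto simp: P_def I_def intro!: edge_var_nth[symmetric])
  also have "\<dots> = (\<Sum>e\<in>cut_edges G S. edge_var G X e)"
  proof (rule sum.reindex_bij_betw, rule bij_betw_imageI)
    show "inj_on (\<lambda>p. {?v (fst p), ?v (snd p)}) P"
      by (auto simp: inj_on_def P_def I_def doubleton_eq_iff v_eq)
    show "(\<lambda>p. {?v (fst p), ?v (snd p)}) ` P = cut_edges G S"
    proof (intro equalityI subsetI)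
      fix e assume "e \<in> (\<lambda>p. {?v (fst p), ?v (snd p)}) ` P"
      then obtain i j where e: "e = {?v i, ?v j}" "e \<in> set (edges G)" "?v i \<in> S" "?v j \<notin> S"
        by (auto simp: P_def I_def)
      then have "e \<inter> S = {?v i}" by auto
      then show "e \<in> cut_edges G S" using e by (simp add: cut_edges_def)
    next
      fix e assume "e \<in> cut_edges G S"
      then have e: "e \<in> set (edges G)" "card (e \<inter> S) = 1" by (auto simp: cut_edges_def)
      then have sub: "e \<subseteq> set (verts G)" "card e = 2"
        using inst by (auto simp: qmstp_instance_def)
      obtain a where a: "e \<inter> S = {a}" using e(2) by (auto simp: card_1_singleton_iff)
      have "a \<in> e" using a by blast
      then obtain b where b: "e = {a, b}" "b \<noteq> a"
        using sub(2) by (metis card_2_iff doubleton_eq_iff insertE singletonD)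
      obtain i j where ij: "i < ?n" "j < ?n" "?v i = a" "?v j = b"
        using sub(1) b by (auto simp: in_set_conv_nth num_verts_def)
      have "a \<in> S" "b \<notin> S" using a b by auto
      then have "(i, j) \<in> P" using ij e(1) b by (auto simp: P_def I_def)
      then show "e \<in> (\<lambda>p. {?v (fst p), ?v (snd p)}) ` P"
        using ij b by (auto intro!: image_eqI[of _ _ "(i, j)"])
    qed
  qed
  finally show ?thesis .
qed

lemma sdp_cut_bound:
  assumes inst: "qmstp_instance G" and S: "S \<subseteq> set (verts G)"
    and feas: "sdp_constraints D G X Y"
  shows "beta G * real (card S) - alpha G * (real (card S))\<^sup>2 \<le> (\<Sum>e\<in>cut_edges G S. edge_var G X e)"
proof -
  define I where "I = {i. i < num_verts G \<and> verts G ! i \<in> S}"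
  have dist: "distinct (verts G)" using inst by (simp add: qmstp_instance_def)
  have "inj_on ((!) (verts G)) I"
    using dist by (auto simp: inj_on_def I_def num_verts_def nth_eq_iff_index_eq)
  moreover have "(!) (verts G) ` I = S"
    using S by (force simp: I_def num_verts_def in_set_conv_nth)
  ultimately have card: "card I = card S" by (metis card_image)
  have X: "X \<in> sym_mats (num_verts G)"
    and supp: "\<And>i j. i < num_verts G \<Longrightarrow> j < num_verts G \<Longrightarrow>
      {verts G ! i, verts G ! j} \<notin> set (edges G) \<Longrightarrow> X $$ (i, j) = 0"
    and psd: "psd (mat_diag (num_verts G) (\<lambda>i. (X *\<^sub>v ones_vec (num_verts G)) $ i) - X
      + alpha G \<cdot>\<^sub>m ones_mat (num_verts G) - beta G \<cdot>\<^sub>m 1\<^sub>m (num_verts G))"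
    using feas by (auto simp: sdp_constraints_def Let_def)
  have "beta G * real (card I) - alpha G * (real (card I))\<^sup>2
      \<le> (\<Sum>i\<in>I. \<Sum>j\<in>{..<num_verts G} - I. X $$ (i, j))"
    using X by (intro laplacian_lmi_cut[OF _ _ psd]) (auto simp: sym_mats_def I_def)
  also have "\<dots> = (\<Sum>e\<in>cut_edges G S. edge_var G X e)"
    unfolding I_def by (rule cut_weight_eq_sum_edge_var[OF inst X supp])
  finally show ?thesis by (simp add: card)
qed

theorem proposition3:
  fixes G :: "'a qmstp" and S :: "'a set"
  assumes "qmstp_instance G"
    and "connected_graph G"
    and "S \<subset> set (verts G)"
    and "S \<noteq> {}"
  shows "cg_cut G (\<lambda>X Y. \<Sum>e \<in> cut_edges G S. edge_var G X e) 1"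
proof -
  define d where "d = beta G * real (card S) - alpha G * (real (card S))\<^sup>2"
  have "finite S" using assms(3) finite_subset by blast
  then have s: "0 < card S" "card S < num_verts G"
    using assms psubset_card_mono[OF _ assms(3)] distinct_card[of "verts G"]
    by (auto simp: card_gt_0_iff num_verts_def qmstp_instance_def)
  have "0 < d" unfolding d_def using s by (rule cut_bound_pos)
  moreover have "d \<le> 1" unfolding d_def using s by (intro cut_bound_le_1) linarith
  ultimately have round: "1 = \<lceil>d\<rceil>" by linarith
  have valid: "d \<le> (\<Sum>e \<in> cut_edges G S. edge_var G X e)" if "relaxation_feasible G X Y" for X Y
    unfolding d_def using that assms(1,3)
    by (intro sdp_cut_bound) (auto simp: relaxation_feasible_def)
  have form: "(\<Sum>e \<in> cut_edges G S. edge_var G X e)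
      = integer_form G (\<lambda>e. of_bool (e \<in> cut_edges G S)) (\<lambda>_. 0) X Y" for X Y
    unfolding integer_form_def
    by (auto simp: cut_edges_def intro!: sum.mono_neutral_cong_left)
  show ?thesis
    unfolding cg_cut_def using form valid round by blast
qed

end
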